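(* Let $R=\mathsf{k}[x_1,\ldots,x_d]$ where $\mathsf{k}$ is a field of characteristic $0$, and let $I=(x_i^{\alpha_i}\mid i\in\operatorname{supp}(\alpha))$ for some $\alpha\in\mathbb{Z}_{\ge 0}^d$. Let $n$ be a positive integer. If $c$ is a rational number with $c\ge\max\{\alpha_1,\ldots,\alpha_d\}$, $c>|\operatorname{supp}(\alpha)|$, and $cn\in\mathbb{Z}$, then $I^{\langle cn\rangle}\subseteq I^n$.
   Context: For $\alpha=(\alpha_1,\dots,\alpha_d)\in\mathbb{Z}_{\ge0}^d$, $\operatorname{supp}(\alpha)=\{i\mid\alpha_i\ne0\}$, and $|\operatorname{supp}(\alpha)|$ is its cardinality. For a commutative $\mathsf{k}$-algebra $R$ and $P,Q\in\operatorname{End}_{\mathsf{k}}(R)$, put $[P,Q]=P\cdot Q-Q\cdot P$. Identify $a\in R$ with the endomorphism "multiplication by $a$". Let $D^0_{\mathsf{k}}(R)\subseteq \operatorname{End}_{\mathsf{k}}(R)$ be the set of multiplications by elements of $R$, and for $i>0$ let $D^i_{\mathsf{k}}(R)=\{\partial\in\operatorname{End}_{\mathsf{k}}(R)\mid [\partial,a]\in D^{i-1}_{\mathsf{k}}(R)\text{ for all }a\in R\}$. For an ideal $I\subseteq R$ and a positive integer $n$, the $n$-th differential power of $I$ is the ideal $I^{\langle n\rangle}=\{r\in R\mid \partial(r)\in I\text{ for all }\partial\in D^{n-1}_{\mathsf{k}}(R)\}$, while $I^n$ is the ordinary power. *)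

theory Defs
  imports Complex_Main "HOL-Library.Poly_Mapping"
begin

text \<open>An ideal is a submodule of the ring over itself, so the library's \<open>module.span\<close> for the
  scalar multiplication \<open>(*)\<close> is the ideal generated by a set.\<close>

lemma module_mult_self: "module ((*) :: 'r::comm_ring_1 \<Rightarrow> 'r \<Rightarrow> 'r)"
  by unfold_locales (simp_all add: algebra_simps)

definition ideal_gen :: "'r::comm_ring_1 set \<Rightarrow> 'r set" where
  "ideal_gen S = module.span (*) S"

definition ideal_mult :: "'r::comm_ring_1 set \<Rightarrow> 'r set \<Rightarrow> 'r set" where
  "ideal_mult I J = ideal_gen {a * b | a b. a \<in> I \<and> b \<in> J}"

primrec ideal_power :: "'r::comm_ring_1 set \<Rightarrow> nat \<Rightarrow> 'r set" where
  "ideal_power I 0 = UNIV"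
| "ideal_power I (Suc n) = ideal_mult I (ideal_power I n)"

text \<open>The algebra structure of the commutative ring \<open>'r\<close> over the field \<open>'k\<close> is given by a
  scalar multiplication \<open>scale\<close>; the endomorphisms are the \<open>'k\<close>-linear maps, not the ring
  homomorphisms.\<close>

definition commutator :: "('r \<Rightarrow> 'r) \<Rightarrow> ('r \<Rightarrow> 'r) \<Rightarrow> 'r \<Rightarrow> 'r::comm_ring_1" where
  "commutator P Q = (\<lambda>r. P (Q r) - Q (P r))"

primrec diff_op :: "('k::field \<Rightarrow> 'r \<Rightarrow> 'r) \<Rightarrow> nat \<Rightarrow> ('r::comm_ring_1 \<Rightarrow> 'r) set" where
  "diff_op scale 0 = {(*) a | a. True}"
| "diff_op scale (Suc i) =
     {P. Vector_Spaces.linear scale scale P \<and> (\<forall>a. commutator P ((*) a) \<in> diff_op scale i)}"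

text \<open>Only meaningful for \<open>n > 0\<close>, because of the truncated subtraction.\<close>

definition diff_power :: "('k::field \<Rightarrow> 'r \<Rightarrow> 'r) \<Rightarrow> 'r::comm_ring_1 set \<Rightarrow> nat \<Rightarrow> 'r set" where
  "diff_power scale I n = {r. \<forall>P \<in> diff_op scale (n - 1). P r \<in> I}"

text \<open>Polynomials over \<open>'k\<close> in variables indexed by \<open>'d\<close>: finitely supported functions from
  exponent vectors to coefficients, with the convolution product of the library. For
  \<open>'d::finite\<close> this is the polynomial ring in \<open>CARD('d)\<close> variables.\<close>

type_synonym ('d, 'k) mpoly = "('d \<Rightarrow>\<^sub>0 nat) \<Rightarrow>\<^sub>0 'k"

definition mvar :: "'d \<Rightarrow> ('d, 'k::field) mpoly" where
  "mvar i = Poly_Mapping.single (Poly_Mapping.single i 1) 1"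

definition mscale :: "'k::field \<Rightarrow> ('d, 'k) mpoly \<Rightarrow> ('d, 'k) mpoly" where
  "mscale c p = Poly_Mapping.single 0 c * p"

lemma vector_space_mscale: "vector_space (mscale :: 'k::field \<Rightarrow> ('d, 'k) mpoly \<Rightarrow> _)"
  by unfold_locales
    (simp_all add: mscale_def algebra_simps single_add mult_single flip: mult.assoc)

lemma mscale_mult_left: "mscale c (p * q) = mscale c p * q"
  by (simp add: mscale_def mult.assoc)

definition supp :: "('d \<Rightarrow> nat) \<Rightarrow> 'd set" where
  "supp \<alpha> = {i. \<alpha> i \<noteq> 0}"

definition var_power_ideal :: "('d \<Rightarrow> nat) \<Rightarrow> ('d, 'k::field) mpoly set" where
  "var_power_ideal \<alpha> = ideal_gen {mvar i ^ \<alpha> i | i. i \<in> supp \<alpha>}"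

end

theory Submission
  imports Defs
begin

text \<open>Both sides of the inclusion are governed by monomials. The ideal \<open>I\<close> consists of polynomials
  all of whose monomials \<open>x\<^sup>m\<close> satisfy \<open>m\<^sub>i \<ge> \<alpha>\<^sub>i\<close> for some \<open>i\<close> in the support of \<open>\<alpha>\<close>
  (\<open>var_power_ideal_keys\<close>), and a polynomial lies in \<open>I\<^sup>n\<close> as soon as each of its monomials satisfies
  \<open>(\<Sum>i. m\<^sub>i div \<alpha>\<^sub>i) \<ge> n\<close>, the sum running over the support (\<open>ideal_power_if_keys\<close>).

  Suppose that \<open>f\<close> contains a monomial \<open>x\<^sup>m\<close> for which this sum \<open>q\<close> is less than \<open>n\<close>. Lower each
  exponent \<open>m\<^sub>i \<ge> \<alpha>\<^sub>i\<close> with \<open>i\<close> in the support to \<open>\<alpha>\<^sub>i - 1\<close>, that is, subtract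
  \<open>b\<^sub>i = m\<^sub>i - (\<alpha>\<^sub>i - 1)\<close>. Division with remainder gives \<open>b\<^sub>i \<le> \<alpha>\<^sub>i (m\<^sub>i div \<alpha>\<^sub>i)\<close>, so
  \<open>(\<Sum>i. b\<^sub>i) \<le> c q \<le> c n - c < c n\<close>, and the iterated partial derivative \<open>\<partial>\<^sup>b\<close> is an operator of
  order at most \<open>c n - 1\<close>. It shifts all exponent vectors by \<open>b\<close> and multiplies the coefficients by
  positive integers, which are units in characteristic zero (\<open>diff_op_shift_exists\<close>), hence no
  cancellation can occur: \<open>\<partial>\<^sup>b f\<close> contains the monomial \<open>x\<^bsup>m - b\<^esup>\<close>, all of whose exponents on the
  support are below \<open>\<alpha>\<^sub>i\<close>. Therefore \<open>\<partial>\<^sup>b f\<close> is not in \<open>I\<close>, and \<open>f\<close> is not in the differential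
  power (\<open>order_less_if_diff_op_in_ideal\<close>).\<close>

abbreviation lookup :: "('a \<Rightarrow>\<^sub>0 'b::zero) \<Rightarrow> 'a \<Rightarrow> 'b" where
  "lookup \<equiv> Poly_Mapping.lookup"

abbreviation keys :: "('a \<Rightarrow>\<^sub>0 'b::zero) \<Rightarrow> 'a set" where
  "keys \<equiv> Poly_Mapping.keys"

section \<open>Differential operators on a commutative algebra\<close>

locale comm_algebra = vector_space scale
  for scale :: "'k::field \<Rightarrow> 'r::comm_ring_1 \<Rightarrow> 'r" +
  assumes scale_mult_left: "scale c (p * q) = scale c p * q"
begin

lemma linear_mult: "Vector_Spaces.linear scale scale ((*) a)"
proof -
  have "a * scale c x = scale c (a * x)" for c x
    by (metis scale_mult_left mult.commute)
  then show ?thesis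
    unfolding Vector_Spaces.linear_iff by (simp add: vector_space_axioms distrib_left)
qed

lemma diff_op_linear: "P \<in> diff_op scale i \<Longrightarrow> Vector_Spaces.linear scale scale P"
  by (cases i) (auto simp: linear_mult)

lemma commutator_mult_mult: "commutator ((*) a) ((*) b) = (\<lambda>_. 0)"
  by (simp add: commutator_def mult.left_commute)

lemma diff_op_zero: "(\<lambda>_. 0) \<in> diff_op scale i"
proof (induction i)
  case 0
  have "(\<lambda>_. 0) = ((*) (0::'r))" by auto
  then show ?case by auto
next
  case (Suc i)
  have "commutator (\<lambda>_. 0) ((*) a) = (\<lambda>_. 0)" for a :: 'r
    by (simp add: commutator_def)
  then show ?case
    using Suc by (simp add: Vector_Spaces.linear_iff vector_space_axioms)
qed

lemma diff_op_add:
  assumes "P \<in> diff_op scale i" "Q \<in> diff_op scale i"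
  shows "(\<lambda>r. P r + Q r) \<in> diff_op scale i"
  using assms
proof (induction i arbitrary: P Q)
  case 0
  then obtain a b where "P = (*) a" "Q = (*) b" by auto
  then have "(\<lambda>r. P r + Q r) = (*) (a + b)" by (auto simp: distrib_right)
  then show ?case by auto
next
  case (Suc i)
  have "commutator (\<lambda>r. P r + Q r) ((*) a)
      = (\<lambda>r. commutator P ((*) a) r + commutator Q ((*) a) r)" for a
    by (auto simp: commutator_def algebra_simps)
  moreover have "Vector_Spaces.linear scale scale (\<lambda>r. P r + Q r)"
    using Suc.prems by (auto simp: Vector_Spaces.linear_iff algebra_simps scale_right_distrib)
  ultimately show ?case
    using Suc by simp
qed

text \<open>Orders are cumulative because multiplications, having order \<open>0\<close>, commute with each other.\<close>

lemma diff_op_Suc_mono: "diff_op scale i \<subseteq> diff_op scale (Suc i)"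
proof (induction i)
  case 0
  have "P \<in> diff_op scale (Suc 0)" if "P \<in> diff_op scale 0" for P
    using that diff_op_zero[of 0] by (auto simp: linear_mult commutator_mult_mult)
  then show ?case by blast
next
  case (Suc i)
  then show ?case by auto
qed

lemma diff_op_mono: "i \<le> j \<Longrightarrow> diff_op scale i \<subseteq> diff_op scale j"
  using lift_Suc_mono_le[of "diff_op scale"] diff_op_Suc_mono by blast

text \<open>Orders add under composition because \<open>[P Q, a] = P [Q, a] + [P, a] Q\<close>, where each summand has
  total order one less. A factor of order \<open>0\<close> commutes with \<open>a\<close>, so its summand vanishes.\<close>

lemma diff_op_comp:
  assumes "P \<in> diff_op scale i" "Q \<in> diff_op scale j"
  shows "P \<circ> Q \<in> diff_op scale (i + j)"
  using assms
proof (induction "i + j" arbitrary: i j P Q)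
  case 0
  then obtain a b where "P = (*) a" "Q = (*) b" by auto
  then have "P \<circ> Q = (*) (a * b)" by (auto simp: mult.assoc)
  with 0 show ?case by auto
next
  case (Suc k)
  have linP: "Vector_Spaces.linear scale scale P" and linQ: "Vector_Spaces.linear scale scale Q"
    using Suc.prems diff_op_linear by blast+
  have Padd: "P (x + y) = P x + P y" for x y
    using linP by (simp add: Vector_Spaces.linear_iff)
  have P0: "P 0 = 0"
    using Padd[of 0 0] by simp
  have Pdiff: "P (x - y) = P x - P y" for x y
    using Padd[of "x - y" y] by simp
  have "commutator (P \<circ> Q) ((*) a) \<in> diff_op scale k" for a
  proof -
    have "commutator (P \<circ> Q) ((*) a)
        = (\<lambda>r. (P \<circ> commutator Q ((*) a)) r + (commutator P ((*) a) \<circ> Q) r)"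
      by (auto simp: commutator_def Pdiff)
    moreover have "P \<circ> commutator Q ((*) a) \<in> diff_op scale k"
    proof (cases j)
      case 0
      then have "P \<circ> commutator Q ((*) a) = (\<lambda>_. 0)"
        using Suc.prems by (auto simp: commutator_mult_mult P0)
      then show ?thesis by (simp add: diff_op_zero)
    next
      case (Suc j')
      then show ?thesis
        using Suc.hyps(1)[of i j' P "commutator Q ((*) a)"] Suc.hyps(2) Suc.prems by simp
    qed
    moreover have "commutator P ((*) a) \<circ> Q \<in> diff_op scale k"
    proof (cases i)
      case 0
      then have "commutator P ((*) a) \<circ> Q = (\<lambda>_. 0)"
        using Suc.prems by (auto simp: commutator_mult_mult)
      then show ?thesis by (simp add: diff_op_zero)
    next
      case (Suc i')
      then show ?thesis
        using Suc.hyps(1)[of i' j "commutator P ((*) a)" Q] Suc.hyps(2) Suc.prems by simp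
    qed
    ultimately show ?thesis by (metis diff_op_add)
  qed
  moreover have "Vector_Spaces.linear scale scale (P \<circ> Q)"
    using linP linQ by (auto simp: Vector_Spaces.linear_iff)
  ultimately have "P \<circ> Q \<in> diff_op scale (Suc k)" by simp
  then show ?case using Suc.hyps(2) by simp
qed

lemma derivation_diff_op:
  assumes "Vector_Spaces.linear scale scale D"
    and leibniz: "\<And>p q. D (p * q) = D p * q + p * D q"
  shows "D \<in> diff_op scale 1"
proof -
  have "commutator D ((*) a) = (*) (D a)" for a
    by (auto simp: commutator_def leibniz)
  then show ?thesis using assms(1) by auto
qed

end

lemma comm_algebra_mscale: "comm_algebra (mscale :: 'k::field \<Rightarrow> ('d, 'k) mpoly \<Rightarrow> _)"
  by (intro comm_algebra.intro vector_space_mscale comm_algebra_axioms.intro mscale_mult_left)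

section \<open>Partial derivatives of polynomials\<close>

lemma poly_mapping_eq_sum_singles:
  "p = (\<Sum>m\<in>keys p. Poly_Mapping.single m (lookup p m))"
proof (rule poly_mapping_eqI)
  fix k
  have "(\<Sum>m\<in>keys p. lookup (Poly_Mapping.single m (lookup p m)) k)
      = (\<Sum>m\<in>keys p. if m = k then lookup p m else 0)"
    by (intro sum.cong) (auto simp: lookup_single when_def)
  then show "lookup p k = lookup (\<Sum>m\<in>keys p. Poly_Mapping.single m (lookup p m)) k"
    by (simp add: lookup_sum in_keys_iff)
qed

lemma poly_mapping_add_induct [case_names zero single add]:
  fixes p :: "'a \<Rightarrow>\<^sub>0 'b::comm_monoid_add"
  assumes zero: "P 0"
    and single: "\<And>m c. P (Poly_Mapping.single m c)"
    and add: "\<And>p q. P p \<Longrightarrow> P q \<Longrightarrow> P (p + q)"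
  shows "P p"
proof -
  have "P (\<Sum>m\<in>A. Poly_Mapping.single m (lookup p m))" if "finite A" for A
    using that by induction (auto intro: assms)
  then show ?thesis
    by (subst poly_mapping_eq_sum_singles[of p]) simp
qed

text \<open>The partial derivative is given through the coefficients of its result, so that the coefficients
  of a composite of such operators can be read off directly.\<close>

lift_definition mderiv :: "'d \<Rightarrow> ('d, 'k::field) mpoly \<Rightarrow> ('d, 'k) mpoly"
  is "\<lambda>i f m. of_nat (lookup m i + 1) * f (m + Poly_Mapping.single i 1)"
proof -
  fix i :: 'd and f :: "('d \<Rightarrow>\<^sub>0 nat) \<Rightarrow> 'k"
  assume fin: "finite {m. f m \<noteq> 0}"
  have "finite ((\<lambda>m. m + Poly_Mapping.single i 1) -` {m. f m \<noteq> 0})"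
    by (rule finite_vimageI[OF fin]) (simp add: inj_def)
  then show "finite {m. of_nat (lookup m i + 1) * f (m + Poly_Mapping.single i 1) \<noteq> 0}"
    by (rule rev_finite_subset) auto
qed

lemma mderiv_add: "mderiv i (p + q) = mderiv i p + mderiv i q"
  by (rule poly_mapping_eqI) (simp only: lookup_add mderiv.rep_eq distrib_left)

lemma mderiv_zero: "mderiv i 0 = 0"
  by (rule poly_mapping_eqI) (simp add: mderiv.rep_eq)

lemma mderiv_single:
  "mderiv i (Poly_Mapping.single m c)
    = Poly_Mapping.single (m - Poly_Mapping.single i 1) (of_nat (lookup m i) * c)"
proof (cases "lookup m i = 0")
  case True
  then have "m \<noteq> k + Poly_Mapping.single i 1" for k
    by (auto simp: lookup_add)
  with True show ?thesis
    by (intro poly_mapping_eqI) (simp add: mderiv.rep_eq lookup_single)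
next
  case False
  then have m: "m = (m - Poly_Mapping.single i 1) + Poly_Mapping.single i 1"
    by (intro poly_mapping_eqI) (auto simp: lookup_add lookup_minus lookup_single when_def)
  have "m = k + Poly_Mapping.single i 1 \<longleftrightarrow> m - Poly_Mapping.single i 1 = k" for k
    using m by (metis add_diff_cancel_right')
  moreover have "lookup m i = lookup k i + 1" if "m = k + Poly_Mapping.single i 1" for k
    using that by (simp add: lookup_add)
  ultimately show ?thesis
    by (intro poly_mapping_eqI) (auto simp: mderiv.rep_eq lookup_single when_def)
qed

lemma mderiv_mult_single:
  "mderiv i (Poly_Mapping.single m a * Poly_Mapping.single k b)
    = mderiv i (Poly_Mapping.single m a) * Poly_Mapping.single k b
      + Poly_Mapping.single m a * mderiv i (Poly_Mapping.single k b)"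
proof -
  let ?e = "Poly_Mapping.single i (1::nat)"
  \<comment> \<open>Truncated subtraction of exponents fails to commute with addition exactly when the exponent of
     the differentiated variable is zero, and then the coefficient vanishes.\<close>
  have shift: "Poly_Mapping.single (u - ?e + v) (of_nat (lookup u i) * x)
      = Poly_Mapping.single (u + v - ?e) (of_nat (lookup u i) * x)" for u v and x :: 'b
  proof (cases "lookup u i = 0")
    case False
    then have "u - ?e + v = u + v - ?e"
      by (intro poly_mapping_eqI) (auto simp: lookup_add lookup_minus lookup_single when_def)
    then show ?thesis by simp
  qed simp
  have "mderiv i (Poly_Mapping.single m a) * Poly_Mapping.single k b
      = Poly_Mapping.single (m + k - ?e) (of_nat (lookup m i) * (a * b))"
    using shift[of m k "a * b"] by (simp add: mderiv_single mult_single mult.assoc)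
  moreover have "Poly_Mapping.single m a * mderiv i (Poly_Mapping.single k b)
      = Poly_Mapping.single (m + k - ?e) (of_nat (lookup k i) * (a * b))"
    using shift[of k m "a * b"]
    by (simp add: mderiv_single mult_single mult.left_commute add.commute)
  ultimately show ?thesis
    by (simp add: mult_single mderiv_single lookup_add distrib_right single_add)
qed

text \<open>Both sides of the Leibniz rule are biadditive, so monomials suffice.\<close>

lemma mderiv_mult: "mderiv i (p * q) = mderiv i p * q + p * mderiv i q"
proof (induction p rule: poly_mapping_add_induct)
  case (single m c)
  show ?case
    by (induction q rule: poly_mapping_add_induct)
      (simp_all add: mderiv_zero mderiv_add mderiv_mult_single algebra_simps)
qed (simp_all add: mderiv_zero mderiv_add algebra_simps)

lemma mderiv_diff_op: "mderiv i \<in> diff_op mscale 1"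
proof (rule comm_algebra.derivation_diff_op[OF comm_algebra_mscale])
  have "mderiv i (Poly_Mapping.single 0 c) = 0" for c :: 'b
    by (simp add: mderiv_single)
  then show "Vector_Spaces.linear mscale mscale (mderiv i :: ('a, 'b) mpoly \<Rightarrow> _)"
    by (simp add: Vector_Spaces.linear_iff vector_space_mscale mderiv_add mscale_def mderiv_mult)
qed (rule mderiv_mult)

text \<open>The operator is the iterated derivative \<open>\<partial>\<^sup>b\<close>. Only the nonvanishing of its coefficients
  matters, and this is where characteristic zero enters.\<close>

lemma diff_op_shift_exists:
  fixes b :: "'d::finite \<Rightarrow>\<^sub>0 nat"
  shows "\<exists>P \<in> diff_op (mscale :: 'k::field_char_0 \<Rightarrow> ('d, 'k) mpoly \<Rightarrow> _) (\<Sum>i\<in>UNIV. lookup b i).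
    \<forall>m. \<exists>u. u \<noteq> 0 \<and> (\<forall>f. lookup (P f) m = u * lookup f (m + b))"
proof (induction "\<Sum>i\<in>UNIV. lookup b i" arbitrary: b)
  case 0
  then have "b = 0"
    by (intro poly_mapping_eqI) simp
  moreover have "(\<lambda>f. f) = ((*) (1 :: ('d, 'k) mpoly))"
    by auto
  ultimately show ?case
    by (intro bexI[of _ "\<lambda>f. f"]) (auto intro!: exI[of _ 1])
next
  case (Suc k)
  then obtain i where i: "lookup b i \<noteq> 0"
    by (metis Suc_neq_Zero sum.neutral)
  define b' where "b' = b - Poly_Mapping.single i 1"
  have b: "b = b' + Poly_Mapping.single i 1"
    using i by (intro poly_mapping_eqI) (auto simp: b'_def lookup_add lookup_minus lookup_single when_def)
  have "(\<Sum>j\<in>UNIV. lookup b j) = (\<Sum>j\<in>UNIV. lookup b' j) + 1"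
    by (simp add: b lookup_add sum.distrib lookup_single when_def)
  then have k: "k = (\<Sum>j\<in>UNIV. lookup b' j)"
    using Suc.hyps(2) by simp
  obtain P where P: "P \<in> diff_op (mscale :: 'k \<Rightarrow> ('d, 'k) mpoly \<Rightarrow> _) k"
    and P_shift: "\<And>m. \<exists>u. u \<noteq> 0 \<and> (\<forall>f. lookup (P f) m = u * lookup f (m + b'))"
    using Suc.hyps(1)[OF k] k by blast
  have "P \<circ> mderiv i \<in> diff_op mscale (k + 1)"
    by (rule comm_algebra.diff_op_comp[OF comm_algebra_mscale P mderiv_diff_op])
  moreover have "\<exists>u. u \<noteq> 0 \<and> (\<forall>f. lookup ((P \<circ> mderiv i) f) m = u * lookup f (m + b))" for m
  proof -
    obtain u where u: "u \<noteq> 0" "\<And>f. lookup (P f) m = u * lookup f (m + b')"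
      using P_shift by blast
    have "u * of_nat (lookup (m + b') i + 1) \<noteq> 0"
      using u(1) by (simp del: of_nat_add of_nat_Suc)
    moreover have "lookup ((P \<circ> mderiv i) f) m
        = u * of_nat (lookup (m + b') i + 1) * lookup f (m + b)" for f
      by (simp add: u(2) mderiv.rep_eq b add.assoc mult.assoc)
    ultimately show ?thesis by blast
  qed
  ultimately show ?case
    using Suc.hyps(2) by (metis Suc_eq_plus1)
qed

section \<open>Powers of an ideal generated by powers of variables\<close>

lemma mvar_power: "mvar i ^ k = Poly_Mapping.single (Poly_Mapping.single i k) 1"
  by (induction k) (simp_all add: mvar_def mult_single flip: single_add)

lemma ideal_mult_closed: "a \<in> I \<Longrightarrow> b \<in> J \<Longrightarrow> a * b \<in> ideal_mult I J"
  unfolding ideal_mult_def ideal_gen_def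
  by (intro module.span_base[OF module_mult_self]) blast

lemma sum_in_ideal_power:
  "(\<And>x. x \<in> A \<Longrightarrow> g x \<in> ideal_power I n) \<Longrightarrow> sum g A \<in> ideal_power I n"
  by (cases n)
    (auto simp: ideal_mult_def ideal_gen_def intro: module.span_sum[OF module_mult_self])

text \<open>The polynomials with this property form an ideal, since multiplication only raises exponents,
  and that ideal contains the generators.\<close>

lemma var_power_ideal_keys:
  fixes f :: "('d, 'k::field) mpoly"
  assumes "f \<in> var_power_ideal \<alpha>" "m \<in> keys f"
  shows "\<exists>i\<in>supp \<alpha>. \<alpha> i \<le> lookup m i"
proof -
  let ?good = "\<lambda>m. \<exists>i\<in>supp \<alpha>. \<alpha> i \<le> lookup m i"
  let ?M = "{f :: ('d, 'k) mpoly. \<forall>m\<in>keys f. ?good m}"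
  have "module.span (*) {mvar i ^ \<alpha> i | i. i \<in> supp \<alpha>} \<subseteq> ?M"
  proof (rule module.span_minimal[OF module_mult_self])
    show "{mvar i ^ \<alpha> i | i. i \<in> supp \<alpha>} \<subseteq> ?M"
      by (force simp: mvar_power)
    show "module.subspace (*) ?M"
    proof (rule module.subspaceI[OF module_mult_self])
      fix p q :: "('d, 'k) mpoly"
      assume "p \<in> ?M" "q \<in> ?M"
      then show "p + q \<in> ?M"
        using keys_add[of p q] by blast
    next
      fix p q :: "('d, 'k) mpoly"
      assume q: "q \<in> ?M"
      have "?good m" if m: "m \<in> keys (p * q)" for m
      proof -
        obtain s t where "m = s + t" "t \<in> keys q"
          using m keys_mult[of p q] by blast
        with q show ?thesis by (auto simp: lookup_add intro: trans_le_add2)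
      qed
      then show "p * q \<in> ?M" by blast
    qed simp
  qed
  with assms show ?thesis
    by (auto simp: var_power_ideal_def ideal_gen_def)
qed

text \<open>The sum counts how many generators \<open>x\<^sub>i ^ \<alpha>\<^sub>i\<close>, with multiplicity, can be split off from \<open>x\<^sup>m\<close>;
  the induction splits them off one at a time.\<close>

lemma single_in_ideal_power:
  fixes m :: "'d::finite \<Rightarrow>\<^sub>0 nat" and a :: "'k::field"
  assumes "n \<le> (\<Sum>i\<in>supp \<alpha>. lookup m i div \<alpha> i)"
  shows "Poly_Mapping.single m a \<in> ideal_power (var_power_ideal \<alpha>) n"
  using assms
proof (induction n arbitrary: m)
  case (Suc n)
  then have "(\<Sum>i\<in>supp \<alpha>. lookup m i div \<alpha> i) \<noteq> 0" by linarith
  then obtain i where i: "i \<in> supp \<alpha>" "lookup m i div \<alpha> i \<noteq> 0"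
    by (rule sum.not_neutral_contains_not_neutral)
  then have le: "\<alpha> i \<le> lookup m i" by (meson div_less not_le)
  have pos: "\<alpha> i > 0" using i(1) by (simp add: supp_def)
  define m' where "m' = m - Poly_Mapping.single i (\<alpha> i)"
  have m: "m = Poly_Mapping.single i (\<alpha> i) + m'"
    using le by (intro poly_mapping_eqI) (auto simp: m'_def lookup_add lookup_minus lookup_single when_def)
  have "lookup m j div \<alpha> j = (if j = i then 1 else 0) + lookup m' j div \<alpha> j" for j
    using pos by (auto simp: m lookup_add lookup_single when_def)
  then have "(\<Sum>j\<in>supp \<alpha>. lookup m j div \<alpha> j) = 1 + (\<Sum>j\<in>supp \<alpha>. lookup m' j div \<alpha> j)"
    using i(1) by (simp add: sum.distrib)
  with Suc have "Poly_Mapping.single m' a \<in> ideal_power (var_power_ideal \<alpha>) n" by simp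
  moreover have "mvar i ^ \<alpha> i \<in> (var_power_ideal \<alpha> :: ('d, 'k) mpoly set)"
    unfolding var_power_ideal_def ideal_gen_def
    using i(1) by (intro module.span_base[OF module_mult_self]) blast
  moreover have "Poly_Mapping.single m a = mvar i ^ \<alpha> i * Poly_Mapping.single m' a"
    by (simp add: mvar_power mult_single m)
  ultimately show ?case
    by (simp add: ideal_mult_closed)
qed simp

lemma ideal_power_if_keys:
  fixes f :: "('d::finite, 'k::field) mpoly"
  assumes "\<And>m. m \<in> keys f \<Longrightarrow> n \<le> (\<Sum>i\<in>supp \<alpha>. lookup m i div \<alpha> i)"
  shows "f \<in> ideal_power (var_power_ideal \<alpha>) n"
  using assms
  by (subst poly_mapping_eq_sum_singles[of f]) (intro sum_in_ideal_power single_in_ideal_power)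

section \<open>The containment\<close>

text \<open>The sum bounds from above the number of derivatives needed to move the monomial \<open>x\<^sup>m\<close> out of the
  ideal: in the variable \<open>i\<close> it takes \<open>m\<^sub>i - (\<alpha>\<^sub>i - 1)\<close> of them if \<open>m\<^sub>i \<ge> \<alpha>\<^sub>i\<close>, and none otherwise.\<close>

lemma order_less_if_diff_op_in_ideal:
  fixes f :: "('d::finite, 'k::field_char_0) mpoly"
  assumes f: "\<And>P. P \<in> diff_op mscale N \<Longrightarrow> P f \<in> var_power_ideal \<alpha>"
    and m: "m \<in> keys f"
  shows "N < (\<Sum>i\<in>supp \<alpha>. \<alpha> i * (lookup m i div \<alpha> i))"
proof (rule ccontr)
  assume "\<not> N < (\<Sum>i\<in>supp \<alpha>. \<alpha> i * (lookup m i div \<alpha> i))"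
  then have N: "(\<Sum>i\<in>supp \<alpha>. \<alpha> i * (lookup m i div \<alpha> i)) \<le> N" by simp
  \<comment> \<open>The truncated subtraction leaves exponents that are already below \<open>\<alpha> i\<close> unchanged.\<close>
  define b where
    "b = Abs_poly_mapping (\<lambda>i. if i \<in> supp \<alpha> then lookup m i - (\<alpha> i - 1) else 0)"
  have b: "lookup b i = (if i \<in> supp \<alpha> then lookup m i - (\<alpha> i - 1) else 0)" for i
    by (simp add: b_def)
  have "lookup b i \<le> \<alpha> i * (lookup m i div \<alpha> i)" if "i \<in> supp \<alpha>" for i
  proof -
    have "lookup m i < \<alpha> i + \<alpha> i * (lookup m i div \<alpha> i)"
      using that by (intro dividend_less_times_div) (simp add: supp_def)
    then show ?thesis unfolding b using that by (simp only: if_True)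
  qed
  then have "(\<Sum>i\<in>supp \<alpha>. lookup b i) \<le> (\<Sum>i\<in>supp \<alpha>. \<alpha> i * (lookup m i div \<alpha> i))"
    by (rule sum_mono)
  moreover have "(\<Sum>i\<in>UNIV. lookup b i) = (\<Sum>i\<in>supp \<alpha>. lookup b i)"
    by (rule sum.mono_neutral_right) (auto simp: b)
  ultimately have order: "(\<Sum>i\<in>UNIV. lookup b i) \<le> N"
    using N by simp
  obtain P where P: "P \<in> diff_op (mscale :: 'k \<Rightarrow> ('d, 'k) mpoly \<Rightarrow> _) (\<Sum>i\<in>UNIV. lookup b i)"
    and P_shift: "\<And>s. \<exists>u. u \<noteq> 0 \<and> (\<forall>f. lookup (P f) s = u * lookup f (s + b))"
    using diff_op_shift_exists[of b, where 'k = 'k] by blast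
  have Pf: "P f \<in> var_power_ideal \<alpha>"
    using comm_algebra.diff_op_mono[OF comm_algebra_mscale order] P f by blast
  have "m - b + b = m"
    by (intro poly_mapping_eqI) (auto simp: lookup_add lookup_minus b)
  moreover obtain u where "u \<noteq> 0" "lookup (P f) (m - b) = u * lookup f (m - b + b)"
    using P_shift by blast
  ultimately have "m - b \<in> keys (P f)"
    using m by (simp add: in_keys_iff)
  from var_power_ideal_keys[OF Pf this] obtain i
    where "i \<in> supp \<alpha>" "\<alpha> i \<le> lookup (m - b) i" by blast
  then show False
    by (auto simp: lookup_minus b supp_def)
qed

theorem theorem5p4:
  fixes \<alpha> :: "'d::finite \<Rightarrow> nat"
    and I :: "('d, 'k::field_char_0) mpoly set"
    and n :: nat
    and c :: rat
  assumes "I = var_power_ideal \<alpha>"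
    and "n > 0"
    and "c \<ge> of_nat (Max (range \<alpha>))"
    and "c > of_nat (card (supp \<alpha>))"
    and "c * of_nat n \<in> \<int>"
  shows "diff_power mscale I (nat \<lfloor>c * of_nat n\<rfloor>) \<subseteq> ideal_power I n"
proof
  fix f assume f: "f \<in> diff_power mscale I (nat \<lfloor>c * of_nat n\<rfloor>)"
  define N where "N = nat \<lfloor>c * of_nat n\<rfloor>"
  have c: "c > 0"
    using assms(4) by (rule le_less_trans[rotated]) simp
  have N: "of_nat N = c * of_nat n"
  proof -
    obtain z where z: "c * of_nat n = of_int z"
      using assms(5) by (elim Ints_cases)
    have "c * of_nat n \<ge> 0"
      using c by simp
    then have "z \<ge> 0"
      unfolding z by simp
    then show ?thesis
      by (simp add: N_def z)
  qed
  have "n \<le> (\<Sum>i\<in>supp \<alpha>. lookup m i div \<alpha> i)" if m: "m \<in> keys f" for m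
  proof (rule ccontr)
    let ?q = "\<Sum>i\<in>supp \<alpha>. lookup m i div \<alpha> i"
    assume "\<not> n \<le> ?q"
    then have q: "?q + 1 \<le> n" by simp
    have "N - 1 < (\<Sum>i\<in>supp \<alpha>. \<alpha> i * (lookup m i div \<alpha> i))"
      by (rule order_less_if_diff_op_in_ideal[OF _ m])
        (use f assms(1) in \<open>auto simp: diff_power_def N_def\<close>)
    also have "\<dots> \<le> (\<Sum>i\<in>supp \<alpha>. Max (range \<alpha>) * (lookup m i div \<alpha> i))"
      by (intro sum_mono mult_right_mono) auto
    also have "\<dots> = Max (range \<alpha>) * ?q"
      by (simp add: sum_distrib_left)
    finally have "N \<le> Max (range \<alpha>) * ?q" by simp
    then have "(of_nat N :: rat) \<le> of_nat (Max (range \<alpha>)) * of_nat ?q"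
      by (metis of_nat_le_iff of_nat_mult)
    also have "\<dots> \<le> c * of_nat ?q"
      using assms(3) by (rule mult_right_mono) (rule of_nat_0_le_iff)
    also have "\<dots> < c * of_nat n"
      using q c by (intro mult_strict_left_mono) (simp_all del: of_nat_sum)
    finally show False using N by simp
  qed
  then show "f \<in> ideal_power I n"
    unfolding assms(1) by (rule ideal_power_if_keys)
qed

end
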